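(* Let $s,\ell\ge 1$ and $k\ge 2$ be integers, and let $p_1,\dots,p_k\ge 1$ be integers with $\sum_{o=1}^k p_o=\ell s$. Consider decks of $\ell s$ cards containing exactly $p_o$ cards of colour $P_o$ for $o=1,\dots,k$. Fix an arbitrary dealing method for $\ell$ players, i.e. a word of length $\ell s$ in the letters $1,\dots,\ell$ in which each letter occurs exactly $s$ times. Let $\omega=(p_{o,j})_{1\le o\le k,\,1\le j\le \ell}\in\Omega$ be a hand, and let $X\ne Y$ be two different colours in $\{P_1,\dots,P_k\}$. Let $x$ be the total number of cards of colour $X$ in the deck, let $x_i$ and $y_i$ be the numbers of cards of colour $X$ and of colour $Y$, respectively, that player $i$ receives in the hand $\omega$, and let $i_1<i_2<\dots<i_s$ be the positions of the letter $i$ in the dealing word. Then $$ \begin{aligned} \sum_{D'\in\mathcal D(\omega)}Z(D',X,Y) &=|\mathcal D(\omega)|\cdot\Bigl((\ell s+1)x+\frac{1}{s}\sum_{i=1}^{\ell}x_i\Bigl(\sum_{\substack{1\le j\le \ell\\ j\neq i}}\frac{\bigl((\sum_{o=1}^k p_{o,j})-x_j-y_j\bigr)\,Z(j,i)}{s}-2\sum_{t=1}^s i_t\Bigr)\Bigr)\\ &=|\mathcal D(\omega)|\cdot\sum_{i=1}^{\ell}x_i\Bigl(\ell s+1-2\,\frac{\sum_{t=1}^{s}i_t}{s}+\sum_{\substack{1\le j\le \ell\\ j\neq i}}\frac{\bigl((\sum_{o=1}^k p_{o,j})-x_j-y_j\bigr)\,Z(j,i)}{s^2}\Bigr). \end{aligned}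 $$
   Context: A deck is an ordered sequence of cards $D'=(D'(1),\dots,D'(\ell s))$, where $D'(m)$ is the colour of the card in position $m$; cards of the same colour are indistinguishable. All decks considered have exactly $p_o$ cards of colour $P_o$. For colours $u\ne v$, a $u$-$v$ pair in $D'$ is a pair of positions $(m,m')$ with $m<m'$, $D'(m)=u$, $D'(m')=v$, and $$Z(D',u,v)=\#\{u\text{-}v\text{ pairs in }D'\}-\#\{v\text{-}u\text{ pairs in }D'\}.$$ A dealing word determines which player receives the card in each position of the deck: the card in position $m$ goes to the player given by the $m$-th letter. For players $j\neq i$, $$Z(j,i)=\#\{j\text{-}i\text{ pairs in the dealing word}\}-\#\{i\text{-}j\text{ pairs in the dealing word}\},$$ where a $j$-$i$ pair in the word is a pair of positions $m<m'$ with letter $j$ at $m$ and letter $i$ at $m'$. The set $\Omega$ of hands consists of all families of non-negative integers $(p_{o,j})_{1\le o\le k,\,1\le j\le \ell}$ with $\sum_{o=1}^k p_{o,j}=s$ for each player $j$ and $\sum_{j=1}^{\ell}p_{o,j}=p_o$ for each $o$; here $p_{o,j}$ is the number of cards of colour $P_o$ received by player $j$. For $\omega\in\Omega$, $\mathcal D(\omega)$ denotes the set of all decks $D'$ that give the hand $\omega$ when dealt according to the fixed dealing word, i.e. for which each player $j$ receives exactly $p_{o,j}$ cards of colour $P_o$ for every $o$. *)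

theory Defs
  imports Complex_Main "HOL-Library.FuncSet"
begin

text \<open>
  The colours $P_1,\dots,P_k$ are represented by their indices \<open>1, \<dots>, k\<close> and the players by
  \<open>1, \<dots>, \<ell>\<close>.  Decks and dealing words are sequences with positions \<open>1, \<dots>, N\<close> (where
  \<open>N = \<ell> * s\<close>), given as extensional functions on \<open>{1..N}\<close>, so that sets of decks have the right
  cardinality.
\<close>

definition uv_pairs :: "nat \<Rightarrow> (nat \<Rightarrow> nat) \<Rightarrow> nat \<Rightarrow> nat \<Rightarrow> (nat \<times> nat) set" where
  "uv_pairs N f u v =
     {(m, m'). m \<in> {1..N} \<and> m' \<in> {1..N} \<and> m < m' \<and> f m = u \<and> f m' = v}"

text \<open>
  Both $Z(D',u,v)$ (for \<open>f\<close> the deck) and $Z(j,i)$ (for \<open>f\<close> the dealing word).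
\<close>

definition pair_diff :: "nat \<Rightarrow> (nat \<Rightarrow> nat) \<Rightarrow> nat \<Rightarrow> nat \<Rightarrow> int" where
  "pair_diff N f u v = int (card (uv_pairs N f u v)) - int (card (uv_pairs N f v u))"

definition decks :: "nat \<Rightarrow> nat \<Rightarrow> (nat \<Rightarrow> nat) \<Rightarrow> (nat \<Rightarrow> nat) set" where
  "decks N k p =
     {D \<in> {1..N} \<rightarrow>\<^sub>E {1..k}. \<forall>c\<in>{1..k}. card {m \<in> {1..N}. D m = c} = p c}"

definition dealing_words :: "nat \<Rightarrow> nat \<Rightarrow> (nat \<Rightarrow> nat) set" where
  "dealing_words l s =
     {w \<in> {1..l * s} \<rightarrow>\<^sub>E {1..l}. \<forall>j\<in>{1..l}. card {m \<in> {1..l * s}. w m = j} = s}"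

text \<open>
  The set $\Omega$; \<open>h c j\<close> is the number of cards of colour \<open>c\<close> received by player \<open>j\<close>.
\<close>

definition hands :: "nat \<Rightarrow> nat \<Rightarrow> nat \<Rightarrow> (nat \<Rightarrow> nat) \<Rightarrow> (nat \<Rightarrow> nat \<Rightarrow> nat) set" where
  "hands k l s p =
     {h \<in> {1..k} \<rightarrow>\<^sub>E ({1..l} \<rightarrow>\<^sub>E UNIV).
        (\<forall>j\<in>{1..l}. (\<Sum>c=1..k. h c j) = s) \<and> (\<forall>c\<in>{1..k}. (\<Sum>j=1..l. h c j) = p c)}"

definition decks_giving ::
  "nat \<Rightarrow> nat \<Rightarrow> nat \<Rightarrow> (nat \<Rightarrow> nat) \<Rightarrow> (nat \<Rightarrow> nat) \<Rightarrow> (nat \<Rightarrow> nat \<Rightarrow> nat) \<Rightarrow> (nat \<Rightarrow> nat) set" where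
  "decks_giving k l s p w h =
     {D \<in> decks (l * s) k p.
        \<forall>c\<in>{1..k}. \<forall>j\<in>{1..l}. card {m \<in> {1..l * s}. w m = j \<and> D m = c} = h c j}"

text \<open>
  \<open>letter_pos N w i t\<close> is $i_t$, the position of the \<open>t\<close>-th occurrence (counting from 1) of the
  letter \<open>i\<close> in \<open>w\<close>; it is meaningful only if \<open>t\<close> lies between 1 and the number of occurrences.
\<close>

definition letter_pos :: "nat \<Rightarrow> (nat \<Rightarrow> nat) \<Rightarrow> nat \<Rightarrow> nat \<Rightarrow> nat" where
  "letter_pos N w i t = sorted_list_of_set {m \<in> {1..N}. w m = i} ! (t - 1)"

end

theory Submission
  imports Defs "HOL-Combinatorics.Transposition"
begin

text \<open>
  Permuting the positions of one player preserves the set of decks giving the hand.  Hence, for a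
  deck drawn uniformly from this set, two fixed positions dealt to distinct players \<open>a\<close> and \<open>b\<close>
  carry the colours \<open>X\<close> and \<open>Y\<close> with probability $x_a y_b / s^2$, while pairs of positions of one
  player contribute nothing on average to $Z(D', X, Y)$.  So the mean of $Z(D', X, Y)$ is
  $\sum_{i,j} x_i y_j Z(i,j) / s^2$.  The stated form follows from the antisymmetry of $Z$, which
  kills $\sum_{i,j} x_i x_j Z(j,i)$, and from
  $\sum_j Z(j,i) = 2 \sum_t i_t - s (\ell s + 1)$, obtained by counting the cards before and after
  each position of player \<open>i\<close>.
\<close>

section \<open>Symmetry of the set of decks under swaps within one player\<close>

lemma finite_decks_giving: "finite (decks_giving k l s p w h)"
proof -
  have "decks_giving k l s p w h \<subseteq> {1..l * s} \<rightarrow>\<^sub>E {1..k}"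
    by (auto simp: decks_giving_def decks_def)
  then show ?thesis
    by (rule finite_subset) (simp add: finite_PiE)
qed

lemma card_Collect_transpose:
  assumes "m \<in> A" "n \<in> A"
  shows "card {q \<in> A. P (transpose m n q)} = card {q \<in> A. P q}"
proof (rule bij_betw_same_card[of "transpose m n"])
  have "transpose m n q \<in> A" if "q \<in> A" for q
    using assms that by (auto simp: transpose_def)
  then show "bij_betw (transpose m n) {q \<in> A. P (transpose m n q)} {q \<in> A. P q}"
    by (intro bij_betw_byWitness[where f' = "transpose m n"]) auto
qed

lemma transpose_decks_giving:
  assumes D: "D \<in> decks_giving k l s p w h"
    and m: "m \<in> {1..l * s}" and n: "n \<in> {1..l * s}" and w: "w m = w n"
  shows "D \<circ> transpose m n \<in> decks_giving k l s p w h"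
proof -
  \<comment> \<open>The dealing word does not notice a swap inside one player's positions, so the
    count of each colour for each player is merely reindexed.\<close>
  have wt: "w q = w (transpose m n q)" for q
    using w by (auto simp: transpose_def)
  have PiE: "D \<in> {1..l * s} \<rightarrow>\<^sub>E {1..k}"
    using D by (auto simp: decks_giving_def decks_def)
  have "D (transpose m n q) \<in> {1..k}" if "q \<in> {1..l * s}" for q
    using PiE m n that by (auto simp: transpose_def)
  moreover have "D (transpose m n q) = undefined" if "q \<notin> {1..l * s}" for q
    using PiE m n that by (auto simp: transpose_def PiE_def extensional_def)
  ultimately have "D \<circ> transpose m n \<in> {1..l * s} \<rightarrow>\<^sub>E {1..k}"
    by (auto simp: PiE_def extensional_def)
  moreover have "card {q \<in> {1..l * s}. (D \<circ> transpose m n) q = c} = p c" if "c \<in> {1..k}" for c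
    using D that card_Collect_transpose[OF m n, of "\<lambda>q. D q = c"]
    by (simp add: decks_giving_def decks_def)
  moreover have "card {q \<in> {1..l * s}. w q = j \<and> (D \<circ> transpose m n) q = c} = h c j"
    if "c \<in> {1..k}" "j \<in> {1..l}" for c j
    using D that card_Collect_transpose[OF m n, of "\<lambda>q. w q = j \<and> D q = c"]
    by (simp add: decks_giving_def flip: wt)
  ultimately show ?thesis
    by (simp add: decks_giving_def decks_def)
qed

text \<open>Composing with the swap is an involution of the set of decks, so the colours at
  \<open>m\<close> and \<open>n\<close> may be exchanged in any event \<open>P\<close>.\<close>

lemma card_decks_giving_transpose:
  assumes "m \<in> {1..l * s}" "n \<in> {1..l * s}" "w m = w n"
  shows "card {D \<in> decks_giving k l s p w h. P (D \<circ> transpose m n)} =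
    card {D \<in> decks_giving k l s p w h. P D}"
proof (rule bij_betw_same_card[of "\<lambda>D. D \<circ> transpose m n"])
  show "bij_betw (\<lambda>D. D \<circ> transpose m n)
     {D \<in> decks_giving k l s p w h. P (D \<circ> transpose m n)} {D \<in> decks_giving k l s p w h. P D}"
    using transpose_decks_giving[OF _ assms]
    by (intro bij_betw_byWitness[where f' = "\<lambda>D. D \<circ> transpose m n"]) (auto simp: comp_assoc)
qed

section \<open>Decks with prescribed colours at two positions\<close>

definition decks_with ::
  "(nat \<Rightarrow> nat) set \<Rightarrow> nat \<Rightarrow> nat \<Rightarrow> nat \<Rightarrow> nat \<Rightarrow> (nat \<Rightarrow> nat) set" where
  "decks_with G m u m' v = {D \<in> G. D m = u \<and> D m' = v}"

text \<open>Swapping \<open>m\<close> and \<open>m'\<close> turns one event into the other.\<close>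

lemma card_decks_with_same_player:
  assumes "m \<in> {1..l * s}" "m' \<in> {1..l * s}" "w m = w m'"
  shows "card (decks_with (decks_giving k l s p w h) m u m' v) =
    card (decks_with (decks_giving k l s p w h) m v m' u)"
  using card_decks_giving_transpose[OF assms, of k p h "\<lambda>D. D m = v \<and> D m' = u"]
  by (simp add: decks_with_def conj_commute)

lemma card_decks_with_cong:
  assumes "m \<in> {1..l * s}" "n \<in> {1..l * s}" "w m = w n"
    and "m' \<in> {1..l * s}" "n' \<in> {1..l * s}" "w m' = w n'" and "w m \<noteq> w m'"
  shows "card (decks_with (decks_giving k l s p w h) m u m' v) =
    card (decks_with (decks_giving k l s p w h) n u n' v)"
proof -
  \<comment> \<open>First \<open>m\<close> is moved to \<open>n\<close>, then \<open>m'\<close> to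
    \<open>n'\<close>. As the players differ, each swap fixes the position that is not being
    moved.\<close>
  have "m' \<noteq> m" "m' \<noteq> n" "n \<noteq> m'" "n \<noteq> n'"
    using assms by auto
  then show ?thesis
    using card_decks_giving_transpose[of m l s n w k p h "\<lambda>D. D m = u \<and> D m' = v"]
      card_decks_giving_transpose[of m' l s n' w k p h "\<lambda>D. D n = u \<and> D m' = v"] assms
    by (simp add: decks_with_def)
qed

text \<open>Double counting of decks against pairs of positions of the two players: all
  \<open>s * s\<close> pairs are carried by equally many decks, and every deck carries the colours
  \<open>u\<close>, \<open>v\<close> at exactly \<open>h u (w m) * h v (w m')\<close> of them.
  Multiplying out keeps the identity in the naturals.\<close>

lemma card_decks_with_distinct_players:
  assumes w: "w \<in> dealing_words l s" and u: "u \<in> {1..k}" and v: "v \<in> {1..k}"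
    and m: "m \<in> {1..l * s}" and m': "m' \<in> {1..l * s}" and neq: "w m \<noteq> w m'"
  shows "card (decks_with (decks_giving k l s p w h) m u m' v) * s\<^sup>2 =
    card (decks_giving k l s p w h) * (h u (w m) * h v (w m'))"
proof -
  let ?G = "decks_giving k l s p w h"
  let ?S = "\<lambda>j. {n \<in> {1..l * s}. w n = j}"
  have a: "w m \<in> {1..l}" and b: "w m' \<in> {1..l}"
    using w m m' by (auto simp: dealing_words_def)
  have "card (decks_with ?G m u m' v) * s\<^sup>2 =
      (\<Sum>(n, n')\<in>?S (w m) \<times> ?S (w m'). card (decks_with ?G m u m' v))"
    using w a b by (simp add: dealing_words_def card_cartesian_product power2_eq_square)
  also have "\<dots> = (\<Sum>(n, n')\<in>?S (w m) \<times> ?S (w m'). card (decks_with ?G n u n' v))"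
    using m m' neq by (intro sum.cong refl) (auto intro!: card_decks_with_cong)
  also have "\<dots> = (\<Sum>q\<in>?S (w m) \<times> ?S (w m'). card {D \<in> ?G. D (fst q) = u \<and> D (snd q) = v})"
    by (simp add: decks_with_def case_prod_unfold)
  also have "\<dots> = (\<Sum>D\<in>?G. card {q \<in> ?S (w m) \<times> ?S (w m'). D (fst q) = u \<and> D (snd q) = v})"
    by (rule sum_multicount_gen) (auto simp: finite_decks_giving)
  also have "\<dots> = (\<Sum>D\<in>?G. h u (w m) * h v (w m'))"
  proof (rule sum.cong)
    fix D assume D: "D \<in> ?G"
    have "{q \<in> ?S (w m) \<times> ?S (w m'). D (fst q) = u \<and> D (snd q) = v} =
        {n \<in> {1..l * s}. w n = w m \<and> D n = u} \<times> {n \<in> {1..l * s}. w n = w m' \<and> D n = v}"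
      by auto
    then show "card {q \<in> ?S (w m) \<times> ?S (w m'). D (fst q) = u \<and> D (snd q) = v} =
        h u (w m) * h v (w m')"
      using D a b u v by (simp add: card_cartesian_product decks_giving_def)
  qed simp
  finally show ?thesis
    by simp
qed

section \<open>From sums over decks to pair counts in the dealing word\<close>

lemma sum_card_uv_pairs:
  assumes "finite G"
  shows "(\<Sum>D\<in>G. card (uv_pairs N D u v)) =
    (\<Sum>(m, m')\<in>{(m, m'). m \<in> {1..N} \<and> m' \<in> {1..N} \<and> m < m'}. card (decks_with G m u m' v))"
    (is "_ = (\<Sum>(m, m')\<in>?P. _ m m')")
proof -
  have fin: "finite ?P"
    by (rule finite_subset[of _ "{1..N} \<times> {1..N}"]) auto
  have "(\<Sum>D\<in>G. card (uv_pairs N D u v)) =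
      (\<Sum>D\<in>G. card {q \<in> ?P. D (fst q) = u \<and> D (snd q) = v})"
    by (intro sum.cong refl arg_cong[where f = card]) (auto simp: uv_pairs_def)
  also have "\<dots> = (\<Sum>q\<in>?P. card {D \<in> G. D (fst q) = u \<and> D (snd q) = v})"
    using assms fin by (intro sum_multicount_gen) auto
  finally show ?thesis
    by (simp add: decks_with_def case_prod_unfold)
qed

text \<open>Position pairs are grouped by the letters they carry; the class of \<open>(a, b)\<close>
  is \<open>uv_pairs N w a b\<close>.\<close>

lemma sum_over_letter_pairs:
  fixes g :: "nat \<Rightarrow> nat \<Rightarrow> real"
  assumes "\<And>m. m \<in> {1..N} \<Longrightarrow> w m \<in> {1..l}"
  shows "(\<Sum>(m, m')\<in>{(m, m'). m \<in> {1..N} \<and> m' \<in> {1..N} \<and> m < m'}. g (w m) (w m')) =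
    (\<Sum>a=1..l. \<Sum>b=1..l. real (card (uv_pairs N w a b)) * g a b)"
    (is "sum ?f ?P = _")
proof -
  have fin: "finite ?P"
    by (rule finite_subset[of _ "{1..N} \<times> {1..N}"]) auto
  have "sum ?f ?P = (\<Sum>r\<in>{1..l} \<times> {1..l}. sum ?f {q \<in> ?P. map_prod w w q = r})"
    using fin assms by (intro sum.group[symmetric]) auto
  also have "\<dots> = (\<Sum>(a, b)\<in>{1..l} \<times> {1..l}. real (card (uv_pairs N w a b)) * g a b)"
  proof (rule sum.cong)
    fix r :: "nat \<times> nat"
    obtain a b where r: "r = (a, b)"
      by (cases r)
    have "{q \<in> ?P. map_prod w w q = r} = uv_pairs N w a b"
      by (auto simp: uv_pairs_def r)
    moreover have "sum ?f (uv_pairs N w a b) = (\<Sum>q\<in>uv_pairs N w a b. g a b)"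
      by (rule sum.cong) (auto simp: uv_pairs_def)
    ultimately show "sum ?f {q \<in> ?P. map_prod w w q = r} =
        (case r of (a, b) \<Rightarrow> real (card (uv_pairs N w a b)) * g a b)"
      by (simp add: r)
  qed simp
  finally show ?thesis
    by (simp add: sum.cartesian_product)
qed

lemma sum_pair_diff_decks_giving:
  assumes s: "s \<ge> 1" and w: "w \<in> dealing_words l s" and u: "u \<in> {1..k}" and v: "v \<in> {1..k}"
  shows "real_of_int (\<Sum>D\<in>decks_giving k l s p w h. pair_diff (l * s) D u v) =
    real (card (decks_giving k l s p w h)) / (real s)\<^sup>2 *
    (\<Sum>i=1..l. \<Sum>j=1..l. real (h u i) * real (h v j) * real_of_int (pair_diff (l * s) w i j))"
proof -
  let ?N = "l * s"
  let ?G = "decks_giving k l s p w h"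
  let ?P = "{(m, m'). m \<in> {1..?N} \<and> m' \<in> {1..?N} \<and> m < m'}"
  let ?c = "real (card ?G) / (real s)\<^sup>2"
  let ?g = "\<lambda>a b. ?c * (real (h u a) * real (h v b) - real (h v a) * real (h u b))"
  have "real (card (decks_with ?G m u m' v)) - real (card (decks_with ?G m v m' u)) =
      ?g (w m) (w m')" if "(m, m') \<in> ?P" for m m'
  proof (cases "w m = w m'")
    \<comment> \<open>Both sides vanish: the two counts agree, and \<open>?g a a\<close> is
      0.\<close>
    case True
    then show ?thesis
      using card_decks_with_same_player[of m l s m' w k p h u v] that by simp
  next
    case False
    have *: "real (card (decks_with ?G m u' m' v')) = ?c * (real (h u' (w m)) * real (h v' (w m')))"
      if "u' \<in> {1..k}" "v' \<in> {1..k}" for u' v'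
    proof -
      have "real (card (decks_with ?G m u' m' v')) * (real s)\<^sup>2 =
          real (card ?G) * (real (h u' (w m)) * real (h v' (w m')))"
        using arg_cong[OF card_decks_with_distinct_players[OF w that _ _ False], of real]
          \<open>(m, m') \<in> ?P\<close> by simp
      then show ?thesis
        using s by (simp add: field_simps)
    qed
    show ?thesis
      unfolding *[OF u v] *[OF v u] by (simp add: algebra_simps)
  qed
  then have "(\<Sum>(m, m')\<in>?P. real (card (decks_with ?G m u m' v)) -
      real (card (decks_with ?G m v m' u))) = (\<Sum>(m, m')\<in>?P. ?g (w m) (w m'))"
    by (intro sum.cong refl) auto
  also have "\<dots> = (\<Sum>a=1..l. \<Sum>b=1..l. real (card (uv_pairs ?N w a b)) * ?g a b)"
    using w by (intro sum_over_letter_pairs) (auto simp: dealing_words_def)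
  also have "\<dots> = ?c * ((\<Sum>a=1..l. \<Sum>b=1..l.
        real (card (uv_pairs ?N w a b)) * (real (h u a) * real (h v b))) -
      (\<Sum>a=1..l. \<Sum>b=1..l. real (card (uv_pairs ?N w a b)) * (real (h v a) * real (h u b))))"
    by (simp only: sum_distrib_left sum_subtractf[symmetric] right_diff_distrib mult.left_commute)
  \<comment> \<open>Renaming \<open>a\<close> and \<open>b\<close> gives both double sums the same
    weights, so that the pair counts combine into \<open>pair_diff\<close>.\<close>
  also have "(\<Sum>a=1..l. \<Sum>b=1..l.
        real (card (uv_pairs ?N w a b)) * (real (h v a) * real (h u b))) =
      (\<Sum>a=1..l. \<Sum>b=1..l. real (card (uv_pairs ?N w b a)) * (real (h v b) * real (h u a)))"
    by (rule sum.swap)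
  finally have "(\<Sum>(m, m')\<in>?P. real (card (decks_with ?G m u m' v)) -
      real (card (decks_with ?G m v m' u))) = ?c *
      (\<Sum>i=1..l. \<Sum>j=1..l. real (h u i) * real (h v j) * real_of_int (pair_diff ?N w i j))"
    by (simp add: pair_diff_def sum_subtractf[symmetric] algebra_simps)
  moreover have "real_of_int (\<Sum>D\<in>?G. pair_diff ?N D u v) =
      (\<Sum>(m, m')\<in>?P. real (card (decks_with ?G m u m' v)) - real (card (decks_with ?G m v m' u)))"
    using arg_cong[OF sum_card_uv_pairs[OF finite_decks_giving[of k l s p w h], of ?N u v], of real]
      arg_cong[OF sum_card_uv_pairs[OF finite_decks_giving[of k l s p w h], of ?N v u], of real]
    by (simp add: pair_diff_def sum_subtractf case_prod_unfold)
  ultimately show ?thesis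
    by simp
qed

section \<open>Antisymmetry and row sums of Z on the dealing word\<close>

lemma pair_diff_swap: "pair_diff N f u v = - pair_diff N f v u"
  by (simp add: pair_diff_def)

lemma sum_pair_diff_antisym:
  fixes c :: "nat \<Rightarrow> real"
  shows "(\<Sum>i\<in>A. \<Sum>j\<in>A. c i * c j * real_of_int (pair_diff N f j i)) = 0" (is "?S = 0")
proof -
  have "?S = (\<Sum>i\<in>A. \<Sum>j\<in>A. c j * c i * real_of_int (pair_diff N f i j))"
    by (rule sum.swap)
  also have "\<dots> = - ?S"
    by (subst pair_diff_swap) (simp add: sum_negf mult.commute)
  finally show ?thesis
    by simp
qed

text \<open>Position \<open>m\<close> has \<open>m - 1\<close> positions before it and
  \<open>N - m\<close> after it, with difference \<open>2 * m - (N + 1)\<close>. The term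
  \<open>j = i\<close> contributes 0.\<close>

lemma sum_pair_diff_letter:
  assumes w: "\<And>m. m \<in> {1..N} \<Longrightarrow> w m \<in> {1..l}"
  shows "(\<Sum>j=1..l. pair_diff N w j i) = (\<Sum>m | m \<in> {1..N} \<and> w m = i. 2 * int m - (int N + 1))"
proof -
  let ?S = "{m \<in> {1..N}. w m = i}"
  have fin: "finite (uv_pairs N w a b)" for a b
    by (rule finite_subset[of _ "{1..N} \<times> {1..N}"]) (auto simp: uv_pairs_def)
  have "(\<Sum>j=1..l. card (uv_pairs N w j i)) = card (\<Union>j\<in>{1..l}. uv_pairs N w j i)"
    by (rule card_UN_disjoint[symmetric]) (auto simp: fin, auto simp: uv_pairs_def)
  \<comment> \<open>Here the letter \<open>i\<close> sits in the second component, hence the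
    swap.\<close>
  also have "(\<Union>j\<in>{1..l}. uv_pairs N w j i) = prod.swap ` (SIGMA m':?S. {1..<m'})"
    using w by (auto simp: uv_pairs_def image_iff)
  also have "card \<dots> = (\<Sum>m\<in>?S. m - 1)"
    by (simp add: card_image inj_on_def)
  finally have before: "(\<Sum>j=1..l. card (uv_pairs N w j i)) = (\<Sum>m\<in>?S. m - 1)" .
  have "(\<Sum>j=1..l. card (uv_pairs N w i j)) = card (\<Union>j\<in>{1..l}. uv_pairs N w i j)"
    by (rule card_UN_disjoint[symmetric]) (auto simp: fin, auto simp: uv_pairs_def)
  also have "(\<Union>j\<in>{1..l}. uv_pairs N w i j) = (SIGMA m:?S. {m<..N})"
    using w by (auto simp: uv_pairs_def)
  also have "card \<dots> = (\<Sum>m\<in>?S. N - m)"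
    by simp
  finally have after: "(\<Sum>j=1..l. card (uv_pairs N w i j)) = (\<Sum>m\<in>?S. N - m)" .
  have "(\<Sum>j=1..l. pair_diff N w j i) = int (\<Sum>m\<in>?S. m - 1) - int (\<Sum>m\<in>?S. N - m)"
    unfolding before[symmetric] after[symmetric] by (simp add: pair_diff_def sum_subtractf)
  also have "\<dots> = (\<Sum>m\<in>?S. int (m - 1) - int (N - m))"
    by (simp only: sum_subtractf of_nat_sum)
  \<comment> \<open>The natural subtractions do not truncate, since
    \<open>1 \<le> m \<le> N\<close>.\<close>
  also have "\<dots> = (\<Sum>m\<in>?S. 2 * int m - (int N + 1))"
    by (rule sum.cong) (auto simp: of_nat_diff)
  finally show ?thesis .
qed

lemma sum_letter_pos:
  assumes "card {m \<in> {1..N}. w m = i} = s"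
  shows "(\<Sum>t=1..s. f (letter_pos N w i t)) = (\<Sum>m | m \<in> {1..N} \<and> w m = i. f m)"
proof -
  let ?xs = "sorted_list_of_set {m \<in> {1..N}. w m = i}"
  have len: "length ?xs = s"
    using assms by simp
  \<comment> \<open>Occurrences are counted from 1, list entries from 0.\<close>
  have "(\<Sum>t=1..s. f (letter_pos N w i t)) = (\<Sum>t<s. f (?xs ! t))"
    by (rule sum.reindex_bij_witness[of _ Suc "\<lambda>t. t - 1"]) (auto simp: letter_pos_def)
  also have "\<dots> = sum_list (map f ?xs)"
    unfolding sum_list_sum_nth length_map len atLeast0LessThan
    by (rule sum.cong[OF refl]) (simp only: lessThan_iff nth_map len)
  also have "\<dots> = (\<Sum>m\<in>set ?xs. f m)"
    by (rule sum_list_distinct_conv_sum_set) simp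
  finally show ?thesis
    by simp
qed

section \<open>Derivation of both closed forms from the mean\<close>

theorem proposition4p1:
  fixes s l k X Y :: nat
    and p w :: "nat \<Rightarrow> nat"
    and \<omega> :: "nat \<Rightarrow> nat \<Rightarrow> nat"
  assumes "s \<ge> 1" and "l \<ge> 1" and "k \<ge> 2"
    and "\<And>c. c \<in> {1..k} \<Longrightarrow> p c \<ge> 1"
    and "(\<Sum>c=1..k. p c) = l * s"
    and "w \<in> dealing_words l s"
    and "\<omega> \<in> hands k l s p"
    and "X \<in> {1..k}" and "Y \<in> {1..k}" and "X \<noteq> Y"
  shows
    "real_of_int (\<Sum>D \<in> decks_giving k l s p w \<omega>. pair_diff (l * s) D X Y) =
       real (card (decks_giving k l s p w \<omega>)) *
       ((real l * real s + 1) * real (p X) +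
        1 / real s *
        (\<Sum>i=1..l. real (\<omega> X i) *
          ((\<Sum>j\<in>{1..l} - {i}.
              (real (\<Sum>c=1..k. \<omega> c j) - real (\<omega> X j) - real (\<omega> Y j)) *
              real_of_int (pair_diff (l * s) w j i) / real s)
           - 2 * (\<Sum>t=1..s. real (letter_pos (l * s) w i t)))))
     \<and>
     real_of_int (\<Sum>D \<in> decks_giving k l s p w \<omega>. pair_diff (l * s) D X Y) =
       real (card (decks_giving k l s p w \<omega>)) *
       (\<Sum>i=1..l. real (\<omega> X i) *
          (real l * real s + 1
           - 2 * ((\<Sum>t=1..s. real (letter_pos (l * s) w i t)) / real s)
           + (\<Sum>j\<in>{1..l} - {i}.
              (real (\<Sum>c=1..k. \<omega> c j) - real (\<omega> X j) - real (\<omega> Y j)) *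
              real_of_int (pair_diff (l * s) w j i) / (real s)\<^sup>2)))"
proof -
  let ?N = "l * s"
  let ?G = "decks_giving k l s p w \<omega>"
  let ?x = "\<lambda>i. real (\<omega> X i)" and ?y = "\<lambda>i. real (\<omega> Y i)"
  let ?z = "\<lambda>j i. real_of_int (pair_diff ?N w j i)"
  let ?L = "\<lambda>i. \<Sum>t=1..s. real (letter_pos ?N w i t)"
  let ?R = "\<lambda>j. real (\<Sum>c=1..k. \<omega> c j) - ?x j - ?y j"
  have s: "real s > 0"
    using assms(1) by simp
  have Zsum: "(\<Sum>j=1..l. ?z j i) = 2 * ?L i - real s * (real ?N + 1)" if "i \<in> {1..l}" for i
  proof -
    have card: "card {m \<in> {1..?N}. w m = i} = s"
      using assms(6) that by (simp add: dealing_words_def)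
    have "(\<Sum>j=1..l. pair_diff ?N w j i) =
        (\<Sum>m | m \<in> {1..?N} \<and> w m = i. 2 * int m - (int ?N + 1))"
      using assms(6) by (intro sum_pair_diff_letter) (auto simp: dealing_words_def)
    from arg_cong[OF this, of real_of_int]
    have "(\<Sum>j=1..l. ?z j i) = (\<Sum>m | m \<in> {1..?N} \<and> w m = i. 2 * real m - (real ?N + 1))"
      by simp
    also have "\<dots> = 2 * (\<Sum>m | m \<in> {1..?N} \<and> w m = i. real m) - real s * (real ?N + 1)"
      using card by (simp add: sum_subtractf sum_distrib_left)
    finally show ?thesis
      by (simp only: sum_letter_pos[OF card])
  qed
  \<comment> \<open>The diagonal may be added because Z(i,i) = 0, and each player holds
    \<open>s\<close> cards. The divisor \<open>d\<close> is \<open>s\<close> in the first form and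
    the square of \<open>s\<close> in the second.\<close>
  have drop_diag: "(\<Sum>j\<in>{1..l} - {i}. ?R j * ?z j i / d) =
      (\<Sum>j=1..l. (real s - ?x j - ?y j) * ?z j i) / d" if "i \<in> {1..l}" for i d
  proof -
    have "(\<Sum>j\<in>{1..l} - {i}. ?R j * ?z j i / d) = (\<Sum>j=1..l. ?R j * ?z j i / d)"
      by (rule sum.mono_neutral_left) (auto simp: pair_diff_def)
    also have "\<dots> = (\<Sum>j=1..l. (real s - ?x j - ?y j) * ?z j i / d)"
      using assms(7) by (intro sum.cong refl) (simp add: hands_def)
    finally show ?thesis
      by (simp add: sum_divide_distrib)
  qed
  \<comment> \<open>The part with \<open>s\<close> is a row sum, known from \<open>Zsum\<close>;
    antisymmetry flips the sign of the Y part.\<close>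
  have expand: "(\<Sum>j=1..l. (real s - ?x j - ?y j) * ?z j i) =
      real s * (2 * ?L i - real s * (real ?N + 1)) -
      (\<Sum>j=1..l. ?x j * ?z j i) + (\<Sum>j=1..l. ?y j * ?z i j)" if "i \<in> {1..l}" for i
  proof -
    have "(\<Sum>j=1..l. (real s - ?x j - ?y j) * ?z j i) =
        real s * (\<Sum>j=1..l. ?z j i) - (\<Sum>j=1..l. ?x j * ?z j i) - (\<Sum>j=1..l. ?y j * ?z j i)"
      by (simp add: left_diff_distrib sum_subtractf sum_distrib_left)
    also have "(\<Sum>j=1..l. ?y j * ?z j i) = - (\<Sum>j=1..l. ?y j * ?z i j)"
      by (subst pair_diff_swap) (simp add: sum_negf)
    finally show ?thesis
      unfolding Zsum[OF that] by simp
  qed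
  \<comment> \<open>\<open>E i\<close> is the factor of \<open>\<omega> X i\<close> in the second
    form.\<close>
  define E where "E i = real l * real s + 1 - 2 * (?L i / real s) +
    (\<Sum>j\<in>{1..l} - {i}. ?R j * ?z j i / (real s)\<^sup>2)" for i
  \<comment> \<open>After division by the square of \<open>s\<close>, the row sum cancels exactly
    the terms \<open>l * s + 1\<close> and \<open>2 * ?L i / s\<close>.\<close>
  have E: "E i = ((\<Sum>j=1..l. ?y j * ?z i j) - (\<Sum>j=1..l. ?x j * ?z j i)) / (real s)\<^sup>2"
    if "i \<in> {1..l}" for i
    unfolding E_def drop_diag[OF that] expand[OF that]
    using s by (simp add: field_simps power2_eq_square)
  have "(\<Sum>i=1..l. ?x i * E i) =
      ((\<Sum>i=1..l. \<Sum>j=1..l. ?x i * ?y j * ?z i j) -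
       (\<Sum>i=1..l. \<Sum>j=1..l. ?x i * ?x j * ?z j i)) / (real s)\<^sup>2"
    by (simp add: E sum_subtractf[symmetric] sum_divide_distrib sum_distrib_left
        right_diff_distrib mult.assoc)
  also have "\<dots> = (\<Sum>i=1..l. \<Sum>j=1..l. ?x i * ?y j * ?z i j) / (real s)\<^sup>2"
    by (simp add: sum_pair_diff_antisym)
  finally have second: "real_of_int (\<Sum>D\<in>?G. pair_diff ?N D X Y) =
      real (card ?G) * (\<Sum>i=1..l. ?x i * E i)"
    using sum_pair_diff_decks_giving[OF assms(1,6,8,9), of p \<omega>] by simp
  \<comment> \<open>Since the \<open>\<omega> X i\<close> add up to \<open>p X\<close>, the constant
    part of \<open>E i\<close> yields the leading term of the first form.\<close>
  have x: "real (p X) = (\<Sum>i=1..l. ?x i)"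
    using assms(7,8) by (simp add: hands_def flip: of_nat_sum)
  have "E i = (real l * real s + 1) + 1 / real s *
      ((\<Sum>j\<in>{1..l} - {i}. ?R j * ?z j i / real s) - 2 * ?L i)" if "i \<in> {1..l}" for i
    unfolding E_def drop_diag[OF that]
    using s by (simp add: field_simps power2_eq_square)
  then have "(\<Sum>i=1..l. ?x i * E i) = (real l * real s + 1) * real (p X) + 1 / real s *
      (\<Sum>i=1..l. ?x i * ((\<Sum>j\<in>{1..l} - {i}. ?R j * ?z j i / real s) - 2 * ?L i))"
    unfolding x sum_distrib_left sum.distrib[symmetric]
    by (intro sum.cong refl) (simp only: ring_distribs mult_ac)
  with second show ?thesis
    unfolding E_def by simp
qed

end
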